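(* Let $\mathbf{n}=(n_1,\ldots,n_d)\in\mathbb{N}^d$ have pairwise relatively prime entries and let $\mathbf{u}\in\{-1,1\}^d$. For $t\in[0,2\pi)$, let $\mathcal{A}^{(\mathbf{n})}(t)$ be the set of all $s\in[0,2\pi)$ with $\ell^{(\mathbf{n})}_{\mathbf{0},\mathbf{u}}(s)=\ell^{(\mathbf{n})}_{\mathbf{0},\mathbf{u}}(t)$. (a) We have: - $\#\mathcal{A}^{(\mathbf{n})}(t)=1$ if $t\in\{t^{(\mathbf{n})}_0,t^{(\mathbf{n})}_{p[\mathbf{n}]}\}=\{0,\pi\}$; - $\#\mathcal{A}^{(\mathbf{n})}(t)=2$ if $t\in[0,2\pi)\setminus\{t^{(\mathbf{n})}_l \mid l\in\{0,\ldots,2p[\mathbf{n}]-1\}\}$; - $\#\mathcal{A}^{(\mathbf{n})}(t)\geq 2$ if $t\in\{t^{(\mathbf{n})}_l \mid l\in\{1,\ldots,2p[\mathbf{n}]-1\}\setminus\{p[\mathbf{n}]\}\}$. (b) Let $M\subseteq\{1,\ldots,d\}$. For $l\in\{0,\ldots,2p[\mathbf{n}]-1\}$ the following are equivalent: (i) for all $i\in M$: $l\not\equiv 0 \bmod n_i$, and for all $i\in\{1,\ldots,d\}\setminus M$: $l\equiv 0\bmod n_i$; (ii) the value $\ell^{(\mathbf{n})}_{\mathbf{0},\mathbf{u}}(t^{(\mathbf{n})}_l)$ is an element of the set $F^d_M$. If (i) or (ii) is satisfied, then $\#\mathcal{A}^{(\mathbf{n})}(t^{(\mathbf{n})}_l)=2^{\#M}$.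 Furthermore, $$\#\mathrm{LD}^{(\mathbf{n})}_{\mathbf{u}}=\frac{1}{2^{d-1}}\prod_{i=1}^d(n_i+1),\qquad \#\bigl(\mathrm{LD}^{(\mathbf{n})}_{\mathbf{u}}\cap F^d_M\bigr)=\frac{1}{2^{\#M-1}}\prod_{i\in M}(n_i-1),$$ where the empty product is $1$.
   Context: $\mathbb{N}=\{1,2,\ldots\}$, $d\in\mathbb{N}$. Set $p[\mathbf{n}]=\prod_{j=1}^d n_j$, $p_i[\mathbf{n}]=\prod_{j\neq i}n_j$, and $t^{(\mathbf{n})}_l=l\pi/p[\mathbf{n}]$ for $l\in\mathbb{Z}$. For $\mathbf{u}\in\{-1,1\}^d$, the curve $\ell^{(\mathbf{n})}_{\mathbf{0},\mathbf{u}}:\mathbb{R}\to[-1,1]^d$ is $$\ell^{(\mathbf{n})}_{\mathbf{0},\mathbf{u}}(t)=\bigl(u_1\cos(p_1[\mathbf{n}]\,t),\ldots,u_d\cos(p_d[\mathbf{n}]\,t)\bigr).$$ Further, $\mathrm{LD}^{(\mathbf{n})}_{\mathbf{u}}=\{\ell^{(\mathbf{n})}_{\mathbf{0},\mathbf{u}}(t^{(\mathbf{n})}_l)\mid l\in\{0,\ldots,p[\mathbf{n}]\}\}$. For $M\subseteq\{1,\ldots,d\}$, $F^d_M$ is the set of all $\mathbf{x}\in[-1,1]^d$ with $x_i\in(-1,1)$ for all $i\in M$ and $x_i\in\{-1,1\}$ for all $i\notin M$. *)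

theory Defs
  imports "HOL-Analysis.Analysis" "HOL-Number_Theory.Cong"
begin

text \<open>The index set \<open>{1, ..., d}\<close> is rendered as the universe of a (nonempty) finite type \<open>'d\<close>, so that
  \<open>d = CARD('d) \<ge> 1\<close>.  Tuples are vectors indexed by \<open>'d\<close>.\<close>

definition pn :: "nat ^ 'd::finite \<Rightarrow> nat" where
  "pn n = (\<Prod>j\<in>UNIV. n $ j)"

definition pn_at :: "nat ^ 'd::finite \<Rightarrow> 'd \<Rightarrow> nat" where
  "pn_at n i = (\<Prod>j\<in>UNIV - {i}. n $ j)"

definition tn :: "nat ^ 'd::finite \<Rightarrow> int \<Rightarrow> real" where
  "tn n l = of_int l * pi / real (pn n)"

text \<open>The Lissajous curve with all phase shifts equal to zero.\<close>

definition lissajous :: "nat ^ 'd::finite \<Rightarrow> real ^ 'd \<Rightarrow> real \<Rightarrow> real ^ 'd" where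
  "lissajous n u t = (\<chi> i. u $ i * cos (real (pn_at n i) * t))"

definition LD :: "nat ^ 'd::finite \<Rightarrow> real ^ 'd \<Rightarrow> (real ^ 'd) set" where
  "LD n u = {lissajous n u (tn n l) | l. l \<in> {0..int (pn n)}}"

definition face :: "'d::finite set \<Rightarrow> (real ^ 'd) set" where
  "face M = {x. (\<forall>i. x $ i \<in> {-1..1}) \<and>
                (\<forall>i\<in>M. x $ i \<in> {-1<..<1}) \<and>
                (\<forall>i\<in>UNIV - M. x $ i \<in> {-1, 1})}"

definition same_points :: "nat ^ 'd::finite \<Rightarrow> real ^ 'd \<Rightarrow> real \<Rightarrow> real set" where
  "same_points n u t = {s \<in> {0..<2 * pi}. lissajous n u s = lissajous n u t}"

end

theory Submission
  imports Defs
begin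

text \<open>In the parameter \<open>x = t p[n] / \<pi>\<close> the \<open>i\<close>-th coordinate of the curve is \<open>\<plusminus>cos (x \<pi> / n\<^sub>i)\<close>, so
  \<open>x\<close> and \<open>y\<close> give the same point iff \<open>x \<equiv> \<plusminus>y\<close> modulo \<open>2 n\<^sub>i\<close> for each \<open>i\<close>. For a non-integer \<open>y\<close>
  the sign cannot depend on \<open>i\<close>, leaving \<open>x \<equiv> \<plusminus>y\<close> modulo \<open>2 p[n]\<close>. For an integer \<open>l\<close> the Chinese
  remainder theorem realises every choice of signs, and the signs matter exactly at the \<open>i\<close> with
  \<open>n\<^sub>i\<close> not dividing \<open>l\<close>; this gives fibres of size \<open>2 ^ card M\<close>. Counting the \<open>l\<close> modulo \<open>2 p[n]\<close>
  with a given \<open>M\<close> and dividing by the fibre size gives the points in a face, and the total is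
  the expansion of \<open>\<Prod>i. ((n\<^sub>i - 1) / 2 + 1)\<close> over all \<open>M\<close>.\<close>

section \<open>Counting by residues and by fibres\<close>

lemma prod_pairwise_coprime_dvd:
  fixes m :: "'a \<Rightarrow> int"
  assumes "\<And>i j. i \<in> A \<Longrightarrow> j \<in> A \<Longrightarrow> i \<noteq> j \<Longrightarrow> coprime (m i) (m j)"
    and "\<And>i. i \<in> A \<Longrightarrow> m i dvd x"
  shows "(\<Prod>i\<in>A. m i) dvd x"
  using assms
proof (induct A rule: infinite_finite_induct)
  case (insert a A)
  have "coprime (m a) (\<Prod>i\<in>A. m i)"
    using insert by (intro prod_coprime_right) auto
  with insert show ?case by (simp add: divides_mult)
qed auto

text \<open>Taking all residues at once is injective on one period, and the box of residues has as
  many elements as the period. So it is a bijection, and it cuts out the product of the sets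
  \<open>S i\<close>.\<close>

lemma card_crt:
  fixes m :: "'a \<Rightarrow> int"
  assumes fin: "finite A"
    and pos: "\<And>i. i \<in> A \<Longrightarrow> m i > 0"
    and cop: "\<And>i j. i \<in> A \<Longrightarrow> j \<in> A \<Longrightarrow> i \<noteq> j \<Longrightarrow> coprime (m i) (m j)"
    and sub: "\<And>i. i \<in> A \<Longrightarrow> S i \<subseteq> {0..<m i}"
  shows "card {k \<in> {0..<\<Prod>i\<in>A. m i}. \<forall>i\<in>A. k mod m i \<in> S i} = (\<Prod>i\<in>A. card (S i))"
proof -
  let ?P = "\<Prod>i\<in>A. m i" and ?r = "\<lambda>k. \<lambda>i\<in>A. k mod m i"
  have inj: "inj_on ?r {0..<?P}"
  proof (rule inj_onI)
    fix x y assume xy: "x \<in> {0..<?P}" "y \<in> {0..<?P}" and eq: "?r x = ?r y"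
    have "m i dvd x - y" if "i \<in> A" for i
      using fun_cong[OF eq, of i] that by (simp add: mod_eq_dvd_iff)
    then have "?P dvd x - y"
      using cop by (intro prod_pairwise_coprime_dvd) auto
    then have "x mod ?P = y mod ?P"
      by (simp add: mod_eq_dvd_iff)
    then show "x = y" using xy by simp
  qed
  have maps: "?r ` {0..<?P} \<subseteq> (\<Pi>\<^sub>E i\<in>A. {0..<m i})"
    using pos by (auto simp: PiE_iff)
  have "card (?r ` {0..<?P}) = nat ?P"
    using inj by (simp add: card_image)
  also have "\<dots> = card (\<Pi>\<^sub>E i\<in>A. {0..<m i})"
    using fin pos by (simp add: card_PiE prod_int_eq nat_eq_iff prod_nonneg less_imp_le)
  finally have surj: "?r ` {0..<?P} = (\<Pi>\<^sub>E i\<in>A. {0..<m i})"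
    using maps fin by (intro card_subset_eq finite_PiE) auto
  have "?r ` {k \<in> {0..<?P}. \<forall>i\<in>A. k mod m i \<in> S i} = (\<Pi>\<^sub>E i\<in>A. S i)" (is "?r ` ?K = ?R")
  proof
    show "?R \<subseteq> ?r ` ?K"
    proof
      fix f assume f: "f \<in> ?R"
      then have "f \<in> (\<Pi>\<^sub>E i\<in>A. {0..<m i})"
        by (rule subsetD[OF PiE_mono, rotated]) (rule sub)
      then have "f \<in> ?r ` {0..<?P}" unfolding surj .
      then obtain k where k: "k \<in> {0..<?P}" "f = ?r k" by auto
      with f show "f \<in> ?r ` ?K" by (auto simp: PiE_iff)
    qed
  qed (auto simp: PiE_iff)
  moreover have "inj_on ?r ?K"
    by (rule inj_on_subset[OF inj]) auto
  ultimately have "card ?K = card ?R"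
    using card_image[of ?r ?K] by (simp only:)
  then show ?thesis using fin by (simp add: card_PiE)
qed

lemma card_eq_mult_card_image:
  assumes "finite A" and "\<And>a. a \<in> A \<Longrightarrow> card {b \<in> A. f b = f a} = c"
  shows "card A = card (f ` A) * c"
proof -
  have "card A = (\<Sum>y\<in>f ` A. card {b \<in> A. f b = y})"
    using sum.image_gen[OF assms(1), of "\<lambda>_. 1::nat" f] by simp
  also have "\<dots> = (\<Sum>y\<in>f ` A. c)"
    using assms(2) by (intro sum.cong) auto
  finally show ?thesis by simp
qed

section \<open>Coincidences of the curve in the rescaled parameter\<close>

locale coprime_frequencies =
  fixes n :: "nat ^ 'd::finite" and u :: "real ^ 'd"
  assumes n_pos: "n $ i \<ge> 1"
    and n_coprime: "i \<noteq> j \<Longrightarrow> coprime (n $ i) (n $ j)"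
    and u_sign: "u $ i \<in> {-1, 1}"
begin

definition P :: int where "P = int (pn n)"

definition X :: "int \<Rightarrow> real ^ 'd" where "X l = lissajous n u (tn n l)"

text \<open>The coordinates in which \<open>X l\<close> avoids 1 and -1; thus \<open>supp l\<close>
  names the face that contains \<open>X l\<close>.\<close>

definition supp :: "int \<Rightarrow> 'd set" where "supp l = {i. \<not> int (n $ i) dvd l}"

lemma n_gt_0 [simp]: "n $ i > 0"
  using n_pos[of i] by simp

lemma P_eq: "P = (\<Prod>i\<in>UNIV. int (n $ i))"
  by (simp add: P_def pn_def)

lemma pn_pos [simp]: "pn n > 0"
  by (simp add: pn_def prod_pos)

lemma n_neq_0 [simp]: "n $ i \<noteq> 0"
  using n_pos[of i] by simp

lemma pn_neq_0 [simp]: "pn n \<noteq> 0"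
  by (simp add: pn_def)

lemma P_pos [simp]: "P > 0"
  by (simp add: P_def)

lemma pn_split: "pn n = n $ i * pn_at n i"
  unfolding pn_def pn_at_def by (rule prod.remove) auto

lemma n_dvd_P: "int (n $ i) dvd P"
  unfolding P_def pn_split[of i] by simp

lemma P_dvd_iff: "P dvd x \<longleftrightarrow> (\<forall>i. int (n $ i) dvd x)"
  using n_coprime unfolding P_eq
  by (auto intro!: prod_pairwise_coprime_dvd dest: dvd_trans[OF n_dvd_P[unfolded P_eq]])

lemma card_residues:
  assumes "\<And>i. S i \<subseteq> {0..<int (n $ i)}"
  shows "card {k \<in> {0..<P}. \<forall>i. k mod int (n $ i) \<in> S i} = (\<Prod>i\<in>UNIV. card (S i))"
  using card_crt[of UNIV "\<lambda>i. int (n $ i)" S] assms n_coprime by (simp add: P_eq)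

lemma scaled_parameter: "(t * pn n / pi) * pi / pn n = t" for t :: real
  by simp

lemma lissajous_nth: "lissajous n u (x * pi / pn n) $ i = u $ i * cos (x * pi / n $ i)" for x :: real
proof -
  have "pn_at n i > 0" using pn_split[of i] pn_pos by (metis gr0I mult_0_right less_irrefl)
  then have "pn_at n i * (x * pi / pn n) = x * pi / n $ i"
    by (simp add: pn_split[of i])
  then show ?thesis by (simp add: lissajous_def)
qed

text \<open>Two cosines agree iff their arguments agree up to sign and multiples of
  \<open>2 * pi\<close>; rescaling turns that period into \<open>2 * n $ i\<close>. The factor
  \<open>u $ i\<close> is nonzero and cancels.\<close>

lemma lissajous_eq_iff:
  "lissajous n u (x * pi / pn n) = lissajous n u (y * pi / pn n) \<longleftrightarrow>
    (\<forall>i. \<exists>k. x = y + of_int (2 * k * int (n $ i)) \<or> x = - y + of_int (2 * k * int (n $ i)))"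
  for x y :: real
proof -
  have "u $ i * cos (x * pi / n $ i) = u $ i * cos (y * pi / n $ i) \<longleftrightarrow>
      (\<exists>k. x = y + of_int (2 * k * int (n $ i)) \<or> x = - y + of_int (2 * k * int (n $ i)))" for i
  proof -
    have "x * pi / n $ i = z * pi / n $ i + 2 * of_int k * pi \<longleftrightarrow> x = z + of_int (2 * k * int (n $ i))" for k z
    proof -
      have "x * pi / n $ i = z * pi / n $ i + 2 * of_int k * pi \<longleftrightarrow>
          x * pi = (z + of_int (2 * k * int (n $ i))) * pi"
        by (simp add: field_simps)
      then show ?thesis by simp
    qed
    from this[of y] this[of "- y"] have "cos (x * pi / n $ i) = cos (y * pi / n $ i) \<longleftrightarrow>
      (\<exists>k. x = y + of_int (2 * k * int (n $ i)) \<or> x = - y + of_int (2 * k * int (n $ i)))"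
      unfolding cos_eq Ints_def by auto
    then show ?thesis using u_sign[of i] by auto
  qed
  then show ?thesis by (simp only: vec_eq_iff lissajous_nth)
qed

lemma tn_eq: "tn n l = of_int l * pi / pn n"
  by (simp add: tn_def)

lemma real_congruence_iff:
  "(\<exists>k. real_of_int m = of_int l + of_int (2 * k * int (n $ i)) \<or>
      real_of_int m = - of_int l + of_int (2 * k * int (n $ i)))
    \<longleftrightarrow> int (2 * n $ i) dvd m - l \<or> int (2 * n $ i) dvd m + l"
proof -
  have "real_of_int m = of_int l + of_int (2 * k * int (n $ i)) \<longleftrightarrow> m - l = int (2 * n $ i) * k" for k l
    unfolding of_int_add[symmetric] of_int_eq_iff by (auto simp: algebra_simps)
  from this[of l] this[of "- l"] show ?thesis
    unfolding dvd_def of_int_minus by auto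
qed

lemma X_eq_iff: "X m = X l \<longleftrightarrow> (\<forall>i. int (2 * n $ i) dvd m - l \<or> int (2 * n $ i) dvd m + l)"
  unfolding X_def tn_eq lissajous_eq_iff real_congruence_iff ..

lemma X_nth: "X l $ i = u $ i * cos (l * pi / n $ i)"
  unfolding X_def tn_eq by (rule lissajous_nth)

section \<open>Nodes and faces\<close>

lemma abs_cos_eq_1_iff: "\<bar>cos (l * pi / n $ i)\<bar> = 1 \<longleftrightarrow> int (n $ i) dvd l" for l :: int
proof -
  have "\<bar>cos (l * pi / n $ i)\<bar> = 1 \<longleftrightarrow> sin (l * pi / n $ i) = 0"
  proof -
    have "\<bar>cos (l * pi / n $ i)\<bar> = 1 \<longleftrightarrow> (cos (l * pi / n $ i))\<^sup>2 = 1"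
      by (simp add: abs_square_eq_1)
    also have "\<dots> \<longleftrightarrow> (sin (l * pi / n $ i))\<^sup>2 = 0"
      using sin_cos_squared_add[of "l * pi / n $ i"] by linarith
    finally show ?thesis by simp
  qed
  also have "\<dots> \<longleftrightarrow> (\<exists>k::int. l * pi / n $ i = k * pi)"
    by (rule sin_zero_iff_int2)
  also have "\<dots> \<longleftrightarrow> (\<exists>k::int. l = int (n $ i) * k)"
  proof -
    have "l * pi / n $ i = k * pi \<longleftrightarrow> real_of_int l = of_int (int (n $ i) * k)" for k :: int
      by (simp add: field_simps)
    then show ?thesis unfolding of_int_eq_iff by simp
  qed
  finally show ?thesis by (simp add: dvd_def)
qed

text \<open>The signs in \<open>u\<close> leave absolute values unchanged, so a coordinate reaches
  the boundary exactly when \<open>n $ i\<close> divides \<open>l\<close>. Each node therefore lies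
  in exactly one face.\<close>

lemma X_in_face_iff: "X l \<in> face M \<longleftrightarrow> supp l = M"
proof -
  have le: "\<bar>X l $ i\<bar> \<le> 1" and eq: "\<bar>X l $ i\<bar> = 1 \<longleftrightarrow> i \<notin> supp l" for i
    using u_sign[of i] abs_cos_eq_1_iff[of l i] by (auto simp: X_nth supp_def abs_mult)
  have "X l \<in> face M \<longleftrightarrow> (\<forall>i\<in>M. \<bar>X l $ i\<bar> \<noteq> 1) \<and> (\<forall>i\<in>-M. \<bar>X l $ i\<bar> = 1)"
  proof -
    have "X l $ i \<in> {-1..1}" "X l $ i \<in> {-1<..<1} \<longleftrightarrow> \<bar>X l $ i\<bar> \<noteq> 1"
      "X l $ i \<in> {-1, 1} \<longleftrightarrow> \<bar>X l $ i\<bar> = 1" for i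
      using le[of i] by auto
    then show ?thesis by (simp add: face_def Compl_eq_Diff_UNIV)
  qed
  then show ?thesis unfolding eq by auto
qed

lemma supp_iff:
  "(\<forall>i\<in>M. \<not> [l = 0] (mod int (n $ i))) \<and> (\<forall>i\<in>UNIV - M. [l = 0] (mod int (n $ i)))
    \<longleftrightarrow> supp l = M"
  by (auto simp: supp_def cong_0_iff)

section \<open>Parameters that share a node\<close>

lemma inj_tn: "inj (tn n)"
  by (rule injI) (simp add: tn_def)

lemma tn_mem_period_iff: "tn n l \<in> {0..<2 * pi} \<longleftrightarrow> l \<in> {0..<2 * P}"
proof -
  have "tn n l < 2 * pi \<longleftrightarrow> real_of_int l < of_int (2 * P)"
    by (simp add: tn_def P_def field_simps)
  moreover have "tn n l \<ge> 0 \<longleftrightarrow> l \<ge> 0"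
    by (auto simp: not_le[THEN iffD2, OF pi_gt_zero] tn_def zero_le_divide_iff zero_le_mult_iff)
  ultimately show ?thesis unfolding of_int_less_iff by auto
qed

lemma same_points_tn: "same_points n u (tn n l) = tn n ` {m \<in> {0..<2 * P}. X m = X l}"
proof
  show "same_points n u (tn n l) \<subseteq> tn n ` {m \<in> {0..<2 * P}. X m = X l}"
  proof
    fix s assume s: "s \<in> same_points n u (tn n l)"
    define x where "x = s * pn n / pi"
    have sx: "s = x * pi / pn n" unfolding x_def scaled_parameter ..
    have "lissajous n u (x * pi / pn n) = lissajous n u (of_int l * pi / pn n)"
      using s unfolding same_points_def tn_eq sx by auto
    \<comment> \<open>A single coordinate already forces \<open>x\<close> to be an integer;
      \<open>undefined\<close> serves as an arbitrary index.\<close>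
    then have "\<exists>k. x = of_int l + of_int (2 * k * int (n $ undefined)) \<or>
        x = - of_int l + of_int (2 * k * int (n $ undefined))"
      unfolding lissajous_eq_iff ..
    then obtain m where "x = of_int m"
      by (metis of_int_add of_int_minus)
    then have m: "s = tn n m" using sx by (simp add: tn_eq)
    then have "m \<in> {0..<2 * P}" "X m = X l"
      using s tn_mem_period_iff[of m] by (auto simp: same_points_def X_def)
    with m show "s \<in> tn n ` {m \<in> {0..<2 * P}. X m = X l}" by auto
  qed
  show "tn n ` {m \<in> {0..<2 * P}. X m = X l} \<subseteq> same_points n u (tn n l)"
    using tn_mem_period_iff by (auto simp: same_points_def X_def)
qed

text \<open>Since \<open>m \<equiv> l\<close> modulo 2, write \<open>m = l + 2 * k\<close>; then \<open>m \<equiv> \<plusminus>l\<close> modulo \<open>2 * n $ i\<close> says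
  \<open>k \<equiv> 0\<close> or \<open>k \<equiv> -l\<close> modulo \<open>n $ i\<close>. This turns the moduli \<open>2 * n $ i\<close> into coprime ones.\<close>

lemma X_shift_eq_iff: "X (l + 2 * k) = X l \<longleftrightarrow> (\<forall>i. k mod int (n $ i) \<in> {0, - l mod int (n $ i)})"
proof -
  have "int (2 * n $ i) dvd (l + 2 * k) - l \<longleftrightarrow> k mod int (n $ i) = 0" for i
    by (simp add: dvd_eq_mod_eq_0)
  moreover have "int (2 * n $ i) dvd (l + 2 * k) + l \<longleftrightarrow> k mod int (n $ i) = - l mod int (n $ i)" for i
  proof -
    have "int (2 * n $ i) dvd (l + 2 * k) + l \<longleftrightarrow> 2 * int (n $ i) dvd 2 * (k - (- l))"
      by (simp add: algebra_simps)
    also have "\<dots> \<longleftrightarrow> int (n $ i) dvd k - (- l)"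
      by (simp only: dvd_mult_cancel_left) simp
    finally show ?thesis by (simp only: mod_eq_dvd_iff)
  qed
  ultimately show ?thesis unfolding X_eq_iff by simp
qed

lemma X_mod: "X (m mod (2 * P)) = X m"
proof -
  have "int (2 * n $ i) dvd 2 * P" for i using n_dvd_P[of i] by simp
  moreover have "2 * P dvd m mod (2 * P) - m"
    by (simp add: mod_eq_dvd_iff[symmetric])
  ultimately show ?thesis unfolding X_eq_iff by (meson dvd_trans)
qed

lemma X_uminus: "X (- m) = X m"
  by (simp add: X_eq_iff)

text \<open>Both alternatives are congruences to an even modulus, and \<open>m - l\<close> and
  \<open>m + l\<close> have equal parity. This supplies the \<open>k\<close> in
  \<open>m = l + 2 * k\<close>.\<close>

lemma X_eq_parity:
  assumes "X m = X l"
  shows "even (m - l)"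
proof -
  have "int (2 * n $ undefined) dvd m - l \<or> int (2 * n $ undefined) dvd m + l"
    using assms X_eq_iff by blast
  then have "2 dvd m - l \<or> 2 dvd m + l"
    by (auto dest: dvd_mult_left)
  then show ?thesis by auto
qed

text \<open>The map from \<open>k\<close> to \<open>l + 2 * k\<close> modulo \<open>2 * P\<close>
  matches the fibre with those \<open>k\<close> modulo \<open>P\<close> that are 0 or
  \<open>- l\<close> modulo each \<open>n $ i\<close>.\<close>

lemma card_fibre: "card {m \<in> {0..<2 * P}. X m = X l} = 2 ^ card (supp l)"
proof -
  let ?K = "{k \<in> {0..<P}. \<forall>i. k mod int (n $ i) \<in> {0, - l mod int (n $ i)}}"
  let ?f = "\<lambda>k. (l + 2 * k) mod (2 * P)"
  have "{m \<in> {0..<2 * P}. X m = X l} = ?f ` ?K"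
  proof
    show "?f ` ?K \<subseteq> {m \<in> {0..<2 * P}. X m = X l}"
      using X_shift_eq_iff by (auto simp: X_mod)
    show "{m \<in> {0..<2 * P}. X m = X l} \<subseteq> ?f ` ?K"
    proof
      fix m assume m: "m \<in> {m \<in> {0..<2 * P}. X m = X l}"
      then have "even (m - l)" using X_eq_parity by blast
      then obtain j where "m - l = 2 * j" by (elim evenE)
      then have j: "m = l + 2 * j" by simp
      define k where "k = j mod P"
      have "?f k = (l + (2 * j) mod (2 * P)) mod (2 * P)"
        by (simp only: k_def mult_mod_right)
      also have "\<dots> = m mod (2 * P)" unfolding j by (rule mod_add_right_eq)
      also have "\<dots> = m" using m by simp
      finally have fk: "?f k = m" .
      then have "X (l + 2 * k) = X l" using X_mod[of "l + 2 * k"] m by simp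
      then have "k \<in> ?K" using X_shift_eq_iff by (auto simp: k_def)
      with fk show "m \<in> ?f ` ?K" by blast
    qed
  qed
  moreover have "inj_on ?f ?K"
  proof (rule inj_onI)
    fix a b assume ab: "a \<in> ?K" "b \<in> ?K" "?f a = ?f b"
    then have "2 * P dvd 2 * (a - b)" by (simp add: mod_eq_dvd_iff algebra_simps)
    then have "P dvd a - b" by (simp only: dvd_mult_cancel_left) simp
    then have "a mod P = b mod P" by (simp only: mod_eq_dvd_iff)
    with ab show "a = b" by simp
  qed
  ultimately have "card {m \<in> {0..<2 * P}. X m = X l} = card ?K"
    by (simp add: card_image)
  also have "\<dots> = (\<Prod>i\<in>UNIV. card {0, - l mod int (n $ i)})"
    by (rule card_residues) auto
  \<comment> \<open>The two admissible residues coincide exactly when \<open>n $ i\<close> divides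
    \<open>l\<close>.\<close>
  also have "\<dots> = (\<Prod>i\<in>UNIV. if i \<in> supp l then 2 else 1)"
    by (rule prod.cong) (auto simp: supp_def dvd_eq_mod_eq_0[symmetric] card_insert_if)
  also have "\<dots> = 2 ^ card (supp l)"
    by (simp add: prod.If_cases)
  finally show ?thesis .
qed

lemma card_same_points_tn: "card (same_points n u (tn n l)) = 2 ^ card (supp l)"
  unfolding same_points_tn card_fibre[symmetric]
  by (intro card_image inj_on_subset[OF inj_tn]) simp

section \<open>Counting the nodes\<close>

text \<open>Since \<open>supp\<close> has period \<open>P\<close>, the range consists of two copies
  of \<open>{0..<P}\<close>. In each, \<open>i\<close> in \<open>M\<close> allows the nonzero
  residues modulo \<open>n $ i\<close>, and any other \<open>i\<close> only zero.\<close>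

lemma card_supp_eq:
  "card {l \<in> {0..<2 * P}. supp l = M} = 2 * (\<Prod>i\<in>M. n $ i - 1)"
proof -
  let ?K = "{k \<in> {0..<P}. supp k = M}"
  have shift: "supp (k + P) = supp k" for k
    using n_dvd_P by (simp add: supp_def dvd_add_left_iff)
  have "{l \<in> {0..<2 * P}. supp l = M} = ?K \<union> (\<lambda>k. k + P) ` ?K"
  proof -
    have "l \<in> ?K \<union> (\<lambda>k. k + P) ` ?K" if "0 \<le> l" "l < 2 * P" "supp l = M" for l
    proof (cases "l < P")
      case False
      then have "l - P \<in> ?K" using that shift[of "l - P"] by auto
      then show ?thesis by (intro UnI2 image_eqI[of _ _ "l - P"]) auto
    qed (use that in auto)
    moreover have "k < 2 * P" if "k < P" "0 \<le> k" for k using that by linarith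
    ultimately show ?thesis using shift by (auto simp: add_nonneg_nonneg less_imp_le)
  qed
  moreover have "?K \<inter> (\<lambda>k. k + P) ` ?K = {}" by auto
  moreover have "finite ?K" by (rule finite_subset[of _ "{0..<P}"]) auto
  ultimately have "card {l \<in> {0..<2 * P}. supp l = M} = card ?K + card ((\<lambda>k. k + P) ` ?K)"
    by (simp only: card_Un_disjoint finite_imageI)
  also have "\<dots> = 2 * card ?K"
    by (simp add: card_image inj_on_def)
  also have "?K = {k \<in> {0..<P}. \<forall>i. k mod int (n $ i) \<in> (if i \<in> M then {1..<int (n $ i)} else {0})}"
  proof -
    have "(k mod int (n $ i) \<in> (if i \<in> M then {1..<int (n $ i)} else {0})) \<longleftrightarrow>
        (i \<in> M \<longleftrightarrow> \<not> int (n $ i) dvd k)" for k i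
    proof -
      have "k mod int (n $ i) \<ge> 0" "k mod int (n $ i) < int (n $ i)" by simp_all
      then show ?thesis unfolding dvd_eq_mod_eq_0 by (auto simp: int_one_le_iff_zero_less order_less_le)
    qed
    then show ?thesis unfolding supp_def by auto
  qed
  also have "card \<dots> = (\<Prod>i\<in>UNIV. card (if i \<in> M then {1..<int (n $ i)} else {0}))"
    by (rule card_residues) auto
  also have "\<dots> = (\<Prod>i\<in>UNIV. if i \<in> M then n $ i - 1 else 1)"
    by (rule prod.cong) (auto simp: nat_diff_distrib)
  also have "\<dots> = (\<Prod>i\<in>M. n $ i - 1)"
    by (simp add: prod.If_cases)
  finally show ?thesis .
qed

text \<open>As \<open>X\<close> is even with period \<open>2 * P\<close>, the indices
  \<open>l\<close> and \<open>2 * P - l\<close> give the same node, so the second half of the period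
  adds no points.\<close>

lemma LD_eq: "LD n u = X ` {0..<2 * P}"
proof -
  have "LD n u = X ` {0..P}"
    by (auto simp: LD_def X_def P_def)
  also have "\<dots> = X ` {0..<2 * P}"
  proof
    show "X ` {0..P} \<subseteq> X ` {0..<2 * P}" 
    proof (intro image_mono subsetI)
      fix l assume "l \<in> {0..P}"
      moreover have "P < 2 * P" by simp
      ultimately show "l \<in> {0..<2 * P}" by (auto intro: le_less_trans)
    qed
    have "X l \<in> X ` {0..P}" if "l \<in> {0..<2 * P}" for l
    proof (cases "l \<le> P")
      case False
      have "X l = X ((- l) mod (2 * P))" by (simp only: X_mod X_uminus)
      also have "(- l) mod (2 * P) = (2 * P - l) mod (2 * P)"
        by (metis diff_0 mod_self mod_diff_left_eq)
      also have "\<dots> = 2 * P - l" using that False by (intro mod_pos_pos_trivial) auto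
      finally show ?thesis using that False by auto
    qed (use that in auto)
    then show "X ` {0..<2 * P} \<subseteq> X ` {0..P}" by blast
  qed
  finally show ?thesis .
qed

text \<open>Equal nodes have equal \<open>supp\<close>, so whole fibres, each of size
  \<open>2 ^ card M\<close>, lie over the face. The halves sit inside the product to prepare the sum
  over all \<open>M\<close>.\<close>

lemma card_LD_face: "real (card (LD n u \<inter> face M)) = 2 * (\<Prod>i\<in>M. (real (n $ i) - 1) / 2)"
proof -
  let ?L = "{l \<in> {0..<2 * P}. supp l = M}"
  have LD: "LD n u \<inter> face M = X ` ?L"
    unfolding LD_eq using X_in_face_iff by auto
  have "card {m \<in> ?L. X m = X l} = 2 ^ card M" if "l \<in> ?L" for l
  proof -
    have "supp m = M" if "X m = X l" for m
      using that \<open>l \<in> ?L\<close> X_in_face_iff[of m M] X_in_face_iff[of l M] by simp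
    then have "{m \<in> ?L. X m = X l} = {m \<in> {0..<2 * P}. X m = X l}" by auto
    then show ?thesis using card_fibre[of l] that by simp
  qed
  then have "card ?L = card (X ` ?L) * 2 ^ card M"
    by (intro card_eq_mult_card_image finite_subset[of ?L "{0..<2 * P}"]) auto
  then have "2 * (\<Prod>i\<in>M. n $ i - 1) = card (LD n u \<inter> face M) * 2 ^ card M"
    unfolding card_supp_eq LD by simp
  then have "real (2 * (\<Prod>i\<in>M. n $ i - 1)) = real (card (LD n u \<inter> face M) * 2 ^ card M)"
    by (rule arg_cong)
  \<comment> \<open>Because \<open>n $ i \<ge> 1\<close>, the natural number subtraction is
    exact.\<close>
  then have "2 * (\<Prod>i\<in>M. real (n $ i) - 1) = real (card (LD n u \<inter> face M)) * 2 ^ card M"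
    using n_pos by (simp add: of_nat_diff)
  then show ?thesis by (simp add: prod_dividef field_simps)
qed

lemma card_LD: "real (card (LD n u)) = 2 * (\<Prod>i\<in>UNIV. (real (n $ i) + 1) / 2)"
proof -
  have "LD n u = (\<Union>M\<in>Pow UNIV. LD n u \<inter> face M)"
    using X_in_face_iff by (auto simp: LD_eq)
  moreover have "card (\<Union>M\<in>Pow UNIV. LD n u \<inter> face M) = (\<Sum>M\<in>Pow UNIV. card (LD n u \<inter> face M))"
    using X_in_face_iff by (intro card_UN_disjoint) (auto simp: LD_eq)
  ultimately have "real (card (LD n u)) = (\<Sum>M\<in>Pow UNIV. real (card (LD n u \<inter> face M)))"
    by (metis of_nat_sum)
  \<comment> \<open>The product of ones gives each term the shape of a summand in the expansion of a
    product of binomials.\<close>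
  also have "\<dots> = 2 * (\<Sum>M\<in>Pow UNIV. (\<Prod>i\<in>M. (real (n $ i) - 1) / 2) * (\<Prod>i\<in>UNIV - M. 1))"
    by (simp add: card_LD_face sum_distrib_left)
  also have "\<dots> = 2 * (\<Prod>i\<in>UNIV. (real (n $ i) - 1) / 2 + 1)"
    by (subst prod_add) simp_all
  also have "\<dots> = 2 * (\<Prod>i\<in>UNIV. (real (n $ i) + 1) / 2)"
    by (simp add: field_simps)
  finally show ?thesis .
qed

section \<open>Points away from the nodes\<close>

text \<open>If \<open>x\<close> agreed with \<open>y\<close> for one frequency and with \<open>- y\<close> for another, then \<open>2 * y\<close> would be
  an even integer; hence one sign serves all coordinates.\<close>

lemma lissajous_eq_off_nodes:
  fixes x y :: real
  assumes y: "y \<notin> \<int>"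
    and eq: "lissajous n u (x * pi / pn n) = lissajous n u (y * pi / pn n)"
  shows "\<exists>q. x = y + of_int (2 * q * P) \<or> x = - y + of_int (2 * q * P)"
proof -
  have ex: "\<exists>k. x = y + of_int (2 * k * int (n $ i)) \<or> x = - y + of_int (2 * k * int (n $ i))" for i
    using eq unfolding lissajous_eq_iff by blast
  have no_mix: False if "x = y + of_int (2 * a)" "x = - y + of_int (2 * b)" for a b
  proof -
    have "y = of_int (b - a)" using that by simp
    then show False using y by (metis Ints_of_int)
  qed
  have uniform: "(\<forall>i. \<exists>k. x = y + of_int (2 * (k * int (n $ i)))) \<or>
      (\<forall>i. \<exists>k. x = - y + of_int (2 * (k * int (n $ i))))"
    using ex no_mix unfolding mult.assoc by metis
  have period: "\<exists>q. x = z + of_int (2 * q * P)"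
    if z: "\<forall>i. \<exists>k. x = z + of_int (2 * (k * int (n $ i)))" for z
  proof -
    obtain k where k: "\<And>i. x = z + of_int (2 * (k i * int (n $ i)))"
      using z by metis
    \<comment> \<open>Half of \<open>x - z\<close>. It does not depend on the index, so every
      \<open>n $ i\<close> divides it, and hence so does \<open>P\<close>.\<close>
    define c where "c = k undefined * int (n $ undefined)"
    have "c = k i * int (n $ i)" for i
    proof -
      have "real_of_int (2 * c) = of_int (2 * (k i * int (n $ i)))"
        using k[of i] k[of undefined] unfolding c_def by linarith
      then show ?thesis unfolding of_int_eq_iff by simp
    qed
    then have "int (n $ i) dvd c" for i by (metis dvd_triv_right)
    then have "P dvd c" unfolding P_dvd_iff by simp
    then obtain q where "c = P * q" by (elim dvdE)
    then have "x = z + of_int (2 * q * P)"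
      using k[of undefined] unfolding c_def[symmetric] by (simp add: mult_ac)
    then show ?thesis ..
  qed
  show ?thesis using uniform period by metis
qed

text \<open>Within one period the congruences leave only \<open>t\<close> and its reflection
  \<open>2 * pi - t\<close>. They differ because the fixed point \<open>pi\<close> is the node
  parameter \<open>tn n P\<close>.\<close>

lemma card_same_points_off_nodes:
  assumes t: "t \<in> {0..<2 * pi}" and off: "\<And>l. t \<noteq> tn n l"
  shows "card (same_points n u t) = 2"
proof -
  define y where "y = t * pn n / pi"
  have ty: "t = y * pi / pn n" unfolding y_def scaled_parameter ..
  have y_not_int: "y \<notin> \<int>"
    using off unfolding ty tn_eq by (auto elim: Ints_cases)
  have range: "s * pi / pn n \<in> {0..<2 * pi} \<longleftrightarrow> 0 \<le> s \<and> s < of_int (2 * P)" for s :: real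
    by (auto simp: not_le[THEN iffD2, OF pi_gt_zero] P_def zero_le_divide_iff zero_le_mult_iff field_simps)
  have y: "0 \<le> y" "y < of_int (2 * P)" using t unfolding ty range by auto
  \<comment> \<open>Strictness keeps the reflection inside the half-open period and makes
    \<open>x + y\<close> positive below.\<close>
  have y0: "0 < y" using y y_not_int by (cases "y = 0") auto
  have reflect: "2 * pi - t = (of_int (2 * P) - y) * pi / pn n"
    unfolding ty by (simp add: P_def field_simps)
  have "same_points n u t = {t, 2 * pi - t}"
  proof
    show "same_points n u t \<subseteq> {t, 2 * pi - t}"
    proof
      fix s assume s: "s \<in> same_points n u t"
      define x where "x = s * pn n / pi"
      have sx: "s = x * pi / pn n" unfolding x_def scaled_parameter ..
      have x: "0 \<le> x" "x < of_int (2 * P)"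
        using s range[of x] unfolding same_points_def sx by auto
      have "lissajous n u (x * pi / pn n) = lissajous n u (y * pi / pn n)"
        using s unfolding same_points_def sx ty by auto
      then consider q where "x = y + of_int (2 * q * P)" | q where "x = - y + of_int (2 * q * P)"
        using lissajous_eq_off_nodes[OF y_not_int] by blast
      then have "x = y \<or> x = of_int (2 * P) - y"
      proof cases
        case 1
        \<comment> \<open>Here \<open>x - y\<close> lies strictly between \<open>- 2 * P\<close> and
          \<open>2 * P\<close>.\<close>
        have "real_of_int (2 * q * P) < of_int (2 * P)" "of_int (- (2 * P)) < real_of_int (2 * q * P)"
          using x y unfolding 1 of_int_minus by linarith+
        then have "q * P < 1 * P" "(- 1) * P < q * P"
          unfolding of_int_less_iff by auto
        then have "q < 1" "- 1 < q"
          unfolding mult_less_cancel_right_pos[OF P_pos] by auto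
        then have "q = 0" by linarith
        then show ?thesis using 1 by simp
      next
        case 2
        \<comment> \<open>Here \<open>x + y\<close> lies strictly between 0 and
          \<open>4 * P\<close>.\<close>
        have "real_of_int (2 * q * P) < of_int (2 * (2 * P))"
          using x y unfolding 2 of_int_mult[of 2 "2 * P"] of_int_numeral by linarith
        moreover have "of_int 0 < real_of_int (2 * q * P)"
          using x y0 unfolding 2 of_int_0 by linarith
        ultimately have "q * P < 2 * P" "0 * P < q * P"
          unfolding of_int_less_iff by auto
        then have "q < 2" "0 < q"
          unfolding mult_less_cancel_right_pos[OF P_pos] by auto
        then have "q = 1" by linarith
        then show ?thesis using 2 by simp
      qed
      then show "s \<in> {t, 2 * pi - t}"
        unfolding sx reflect unfolding ty by auto
    qed
    have "lissajous n u (2 * pi - t) = lissajous n u t"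
      unfolding reflect unfolding ty lissajous_eq_iff
    proof
      fix i
      obtain c where "P = int (n $ i) * c" using n_dvd_P[of i] by (elim dvdE)
      then have "of_int (2 * P) - y = - y + of_int (2 * c * int (n $ i))"
        by simp
      then show "\<exists>k. of_int (2 * P) - y = y + of_int (2 * k * int (n $ i)) \<or>
          of_int (2 * P) - y = - y + of_int (2 * k * int (n $ i))"
        by blast
    qed
    moreover have "t > 0" using y0 unfolding ty by simp
    ultimately show "{t, 2 * pi - t} \<subseteq> same_points n u t"
      using t by (auto simp: same_points_def)
  qed
  moreover have "t \<noteq> 2 * pi - t"
  proof
    assume "t = 2 * pi - t"
    then have "t = tn n P" by (simp add: tn_def P_def)
    then show False using off by blast
  qed
  ultimately show ?thesis by simp
qed

text \<open>In one period this singles out \<open>l = 0\<close> and \<open>l = P\<close>, the nodes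
  at corners of the cube, whose fibres are singletons.\<close>

lemma supp_eq_empty_iff: "supp l = {} \<longleftrightarrow> P dvd l"
  by (simp add: supp_def P_dvd_iff)

end

theorem theorem1p4:
  fixes n :: "nat ^ 'd::finite" and u :: "real ^ 'd"
  assumes n_pos: "\<forall>i. n $ i \<ge> 1"
    and n_coprime: "\<forall>i j. i \<noteq> j \<longrightarrow> coprime (n $ i) (n $ j)"
    and u_sign: "\<forall>i. u $ i \<in> {-1, 1}"
  shows
    "({tn n 0, tn n (int (pn n))} = {0, pi} \<and>
      (\<forall>t\<in>{0..<2 * pi}.
         (t \<in> {tn n 0, tn n (int (pn n))} \<longrightarrow> card (same_points n u t) = 1) \<and>
         (t \<notin> {tn n l | l. l \<in> {0..2 * int (pn n) - 1}} \<longrightarrow> card (same_points n u t) = 2) \<and>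
         (t \<in> {tn n l | l. l \<in> {1..2 * int (pn n) - 1} - {int (pn n)}} \<longrightarrow>
            card (same_points n u t) \<ge> 2)))
     \<and>
     (\<forall>M :: 'd set.
        (\<forall>l\<in>{0..2 * int (pn n) - 1}.
           (((\<forall>i\<in>M. \<not> [l = 0] (mod int (n $ i))) \<and>
             (\<forall>i\<in>UNIV - M. [l = 0] (mod int (n $ i))))
            \<longleftrightarrow> lissajous n u (tn n l) \<in> face M) \<and>
           (((\<forall>i\<in>M. \<not> [l = 0] (mod int (n $ i))) \<and>
             (\<forall>i\<in>UNIV - M. [l = 0] (mod int (n $ i))))
            \<or> lissajous n u (tn n l) \<in> face M
            \<longrightarrow> card (same_points n u (tn n l)) = 2 ^ card M)) \<and>
        real (card (LD n u)) =
          1 / 2 powi (int CARD('d) - 1) * (\<Prod>i\<in>UNIV. real (n $ i) + 1) \<and>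
        real (card (LD n u \<inter> face M)) =
          1 / 2 powi (int (card M) - 1) * (\<Prod>i\<in>M. real (n $ i) - 1))"
proof -
  interpret coprime_frequencies n u
    using assms by unfold_locales auto
  have nodes: "{tn n 0, tn n (int (pn n))} = {0, pi}"
    by (simp add: tn_def)
  have at_ends: "card (same_points n u t) = 1" if "t \<in> {tn n 0, tn n (int (pn n))}" for t
    using that supp_eq_empty_iff by (auto simp: card_same_points_tn P_def)
  have off_nodes: "card (same_points n u t) = 2"
    if "t \<in> {0..<2 * pi}" "t \<notin> {tn n l | l. l \<in> {0..2 * int (pn n) - 1}}" for t
  proof (rule card_same_points_off_nodes)
    \<comment> \<open>An index outside the listed range gives a parameter outside the period, which
      cannot equal \<open>t\<close> either.\<close>
    show "t \<noteq> tn n l" for l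
      using that tn_mem_period_iff[of l] by (auto simp: P_def)
  qed (fact that(1))
  have at_nodes: "card (same_points n u t) \<ge> 2"
    if t: "t \<in> {tn n l | l. l \<in> {1..2 * int (pn n) - 1} - {int (pn n)}}" for t
  proof -
    obtain l where l: "t = tn n l" "1 \<le> l" "l < 2 * P" "l \<noteq> P"
      using t by (auto simp: P_def)
    \<comment> \<open>The only multiple of \<open>P\<close> strictly between 0 and
      \<open>2 * P\<close> is \<open>P\<close> itself.\<close>
    have "\<not> P dvd l"
    proof
      assume "P dvd l"
      then obtain q where q: "l = P * q" by (auto simp: dvd_def)
      then have "0 < P * q" "P * q < P * 2" "q \<noteq> 1"
        using l by auto
      then have "0 < q" "q < 2" "q \<noteq> 1"
        using zero_less_mult_pos[OF _ P_pos] mult_less_cancel_left_pos[OF P_pos] by blast+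
      then show False by linarith
    qed
    then have "card (supp l) > 0"
      using supp_eq_empty_iff by (simp add: card_gt_0_iff)
    then have "(2::nat) ^ 1 \<le> 2 ^ card (supp l)"
      by (intro power_increasing) auto
    then show ?thesis by (simp add: l card_same_points_tn)
  qed
  have "real (card (LD n u)) = 1 / 2 powi (int CARD('d) - 1) * (\<Prod>i\<in>UNIV. real (n $ i) + 1)"
    by (simp add: card_LD prod_dividef power_int_diff)
  \<comment> \<open>For \<open>M = {}\<close> the exponent is -1, and the formula gives the two
    corner nodes.\<close>
  moreover have "real (card (LD n u \<inter> face M)) =
      1 / 2 powi (int (card M) - 1) * (\<Prod>i\<in>M. real (n $ i) - 1)" for M
    by (simp add: card_LD_face prod_dividef power_int_diff)
  moreover have "lissajous n u (tn n l) \<in> face M \<longleftrightarrow> supp l = M" for l M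
    using X_in_face_iff by (simp add: X_def)
  ultimately show ?thesis
    unfolding supp_iff using nodes at_ends off_nodes at_nodes
    by (auto simp: card_same_points_tn)
qed

end
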